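(* Let $Q\in\mathbb R^{n\times n}$ be symmetric positive semidefinite, $A\in\mathbb R^{m\times n}$ with $A\neq 0$, $b\in\mathbb R^m$, $c\in\mathbb R^n$, and assume that the set $\mathcal Z^*$ of saddle points of $$\min_{x\in\mathbb R^n}\max_{y\in\mathbb R^m_+}\ \mathcal L(x,y)=\tfrac12x^TQx+c^Tx+y^TAx-b^Ty$$ is nonempty. Let $z^{0,0}=(x^{0,0},y^{0,0})$ be an initial point, let $K\ge 1$ be an integer (the restart frequency), and let $\{z^{n,0}\}_{n\ge 0}$ be the sequence generated by the restarted accelerated PDHG algorithm (rAPDHG, defined in the context) started from $z^{0,0}$, with restart frequency $K$ and parameters, for $0\le k\le K-1$, $$\beta_k=\frac{k+2}{2},\quad \theta_k=\frac{k}{k+1},\quad \eta_k=\frac{k+1}{2(\|Q\|+K\|A\|)},\quad \tau_k=\frac{k+1}{2K\|A\|}.$$ Let $\xi>0$ be arbitrary, and suppose that the smoothed duality gap $G_\xi$ satisfies quadratic growth with parameter $\alpha_\xi>0$ on the ball $B_R(z^{0,0})$ of center $z^{0,0}$ and radius $R=\frac{3}{1-1/e}\,\mathrm{dist}(z^{0,0},\mathcal Z^* )$. Suppose $$K\ \ge\ \max\left\{\sqrt{\frac{32e^2\|Q\|}{\alpha_\xi}},\ \frac{32e^2\|A\|}{\alpha_\xi},\ \sqrt{\frac{64\|Q\|}{\xi}},\ \frac{64\|A\|}{\xi},\ \frac{\|Q\|}{\|A\|}\right\}.$$ Then for every outer iteration $n\ge 0$: (i) $\|z^{n,0}-z^{0,0}\|\le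 \frac{3}{1-1/e}\,\mathrm{dist}(z^{0,0},\mathcal Z^* )$, i.e. $z^{n,0}\in B_R(z^{0,0})$; (ii) $\mathrm{dist}(z^{n,0},\mathcal Z^* )\le e^{-n}\,\mathrm{dist}(z^{0,0},\mathcal Z^* )$.
   Context: Norms: $\|\cdot\|$ is the Euclidean norm on vectors and the spectral norm on matrices; $\mathrm{dist}(z,\mathcal Z^* )=\min_{z'\in\mathcal Z^*}\|z-z'\|$; $B_R(z)=\{\hat z:\|\hat z-z\|\le R\}$. Write $z=(x,y)$ and $\mathcal Z=\mathbb R^n\times\mathbb R^m_+$. A saddle point is $z^*=(x^*,y^* )\in\mathcal Z$ with $\mathcal L(x^*,y)\le\mathcal L(x^*,y^* )\le\mathcal L(x,y^* )$ for all $(x,y)\in\mathcal Z$. Smoothed duality gap: for $\xi>0$, $z=(x,y)\in\mathcal Z$ and $\dot z\in\mathcal Z$, $$G_\xi(z;\dot z)=\max_{\hat z=(\hat x,\hat y)\in\mathcal Z}\left\{\mathcal L(x,\hat y)-\mathcal L(\hat x,y)-\frac{\xi}{2}\|\hat z-\dot z\|^2\right\}.$$ Quadratic growth with parameter $\alpha_\xi>0$ on a set $\mathbb S$ means: $G_\xi(z;z^* )\ge\alpha_\xi\,\mathrm{dist}^2(z,\mathcal Z^* )$ for all $z^*\in\mathcal Z^*$ and all $z\in\mathbb S\cap\mathcal Z$. Algorithm rAPDHG: for outer iterations $n=0,1,2,\dots$, set $(\bar x^{n,0},\bar y^{n,0})=(x^{n,0},y^{n,0})$ and for $k=0,\dots,K-1$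 compute $$x_{md}^{n,k}=(1-\beta_k^{-1})\bar x^{n,k}+\beta_k^{-1}x^{n,k},$$ $$y^{n,k+1}=\mathrm{proj}_{\mathbb R^m_+}\{y^{n,k}+\tau_k(A(\theta_k(x^{n,k}-x^{n,k-1})+x^{n,k})-b)\},$$ $$x^{n,k+1}=x^{n,k}-\eta_k(Qx_{md}^{n,k}+c+A^Ty^{n,k+1}),$$ $$\bar x^{n,k+1}=(1-\beta_k^{-1})\bar x^{n,k}+\beta_k^{-1}x^{n,k+1},\qquad \bar y^{n,k+1}=(1-\beta_k^{-1})\bar y^{n,k}+\beta_k^{-1}y^{n,k+1}.$$ Then restart: $z^{n+1,0}=(x^{n+1,0},y^{n+1,0})=(\bar x^{n,K},\bar y^{n,K})$. (Since $\theta_0=0$, the value of $x^{n,-1}$ is irrelevant.) *)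

theory Defs
  imports "HOL-Analysis.Analysis"
begin

abbreviation spectral_norm :: "real^'n^'m \<Rightarrow> real" where
  "spectral_norm M \<equiv> onorm (\<lambda>v. M *v v)"

definition sym_psd :: "real^'n^'n \<Rightarrow> bool" where
  "sym_psd Q \<longleftrightarrow> transpose Q = Q \<and> (\<forall>x. 0 \<le> x \<bullet> (Q *v x))"

definition nonneg_orthant :: "(real^'m) set" where
  "nonneg_orthant = {y. \<forall>i. 0 \<le> y $ i}"

definition feasible :: "((real^'n) \<times> (real^'m)) set" where
  "feasible = UNIV \<times> nonneg_orthant"

definition lagrangian ::
  "real^'n^'n \<Rightarrow> real^'n^'m \<Rightarrow> real^'m \<Rightarrow> real^'n \<Rightarrow> real^'n \<Rightarrow> real^'m \<Rightarrow> real" where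
  "lagrangian Q A b c x y = 1/2 * (x \<bullet> (Q *v x)) + c \<bullet> x + y \<bullet> (A *v x) - b \<bullet> y"

definition saddle_points ::
  "real^'n^'n \<Rightarrow> real^'n^'m \<Rightarrow> real^'m \<Rightarrow> real^'n \<Rightarrow> ((real^'n) \<times> (real^'m)) set" where
  "saddle_points Q A b c =
     {(xs, ys) \<in> feasible. \<forall>(x, y) \<in> feasible.
        lagrangian Q A b c xs y \<le> lagrangian Q A b c xs ys \<and>
        lagrangian Q A b c xs ys \<le> lagrangian Q A b c x ys}"

definition gap_objective ::
  "real^'n^'n \<Rightarrow> real^'n^'m \<Rightarrow> real^'m \<Rightarrow> real^'n \<Rightarrow> real \<Rightarrow>
   (real^'n) \<times> (real^'m) \<Rightarrow> (real^'n) \<times> (real^'m) \<Rightarrow> (real^'n) \<times> (real^'m) \<Rightarrow> real" where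
  "gap_objective Q A b c \<xi> z zd w =
     lagrangian Q A b c (fst z) (snd w) - lagrangian Q A b c (fst w) (snd z)
       - \<xi> / 2 * (norm (w - zd))\<^sup>2"

text \<open>The supremum is a maximum when \<open>\<xi> > 0\<close>: see \<open>smoothed_gap_attained\<close> below.\<close>

definition smoothed_gap ::
  "real^'n^'n \<Rightarrow> real^'n^'m \<Rightarrow> real^'m \<Rightarrow> real^'n \<Rightarrow> real \<Rightarrow>
   (real^'n) \<times> (real^'m) \<Rightarrow> (real^'n) \<times> (real^'m) \<Rightarrow> real" where
  "smoothed_gap Q A b c \<xi> z zd = (SUP w\<in>feasible. gap_objective Q A b c \<xi> z zd w)"

definition quadratic_growth ::
  "real^'n^'n \<Rightarrow> real^'n^'m \<Rightarrow> real^'m \<Rightarrow> real^'n \<Rightarrow> real \<Rightarrow> real \<Rightarrow>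
   ((real^'n) \<times> (real^'m)) set \<Rightarrow> bool" where
  "quadratic_growth Q A b c \<xi> \<alpha> S \<longleftrightarrow>
     (\<forall>zs \<in> saddle_points Q A b c. \<forall>z \<in> S \<inter> feasible.
        smoothed_gap Q A b c \<xi> z zs \<ge> \<alpha> * (infdist z (saddle_points Q A b c))\<^sup>2)"

text \<open>The state of the inner loop is \<open>(x\<^sup>k\<^sup>-\<^sup>1, x\<^sup>k, y\<^sup>k, \<bar>x\<^sup>k, \<bar>y\<^sup>k)\<close>, where the last two
  components are the weighted averages.  The component \<open>x\<^sup>-\<^sup>1\<close> is set to \<open>x\<^sup>0\<close>; it is multiplied
  by \<open>\<theta> 0\<close>, which is zero for the parameters of interest.\<close>

fun apdhg_step ::
  "real^'n^'n \<Rightarrow> real^'n^'m \<Rightarrow> real^'m \<Rightarrow> real^'n \<Rightarrow>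
   (nat \<Rightarrow> real) \<Rightarrow> (nat \<Rightarrow> real) \<Rightarrow> (nat \<Rightarrow> real) \<Rightarrow> (nat \<Rightarrow> real) \<Rightarrow> nat \<Rightarrow>
   (real^'n) \<times> (real^'n) \<times> (real^'m) \<times> (real^'n) \<times> (real^'m) \<Rightarrow>
   (real^'n) \<times> (real^'n) \<times> (real^'m) \<times> (real^'n) \<times> (real^'m)" where
  "apdhg_step Q A b c \<beta> \<theta> \<eta> \<tau> k (xprev, x, y, xbar, ybar) =
     (let xmd = (1 - inverse (\<beta> k)) *\<^sub>R xbar + inverse (\<beta> k) *\<^sub>R x;
          y' = closest_point nonneg_orthant
                 (y + \<tau> k *\<^sub>R (A *v (\<theta> k *\<^sub>R (x - xprev) + x) - b));
          x' = x - \<eta> k *\<^sub>R (Q *v xmd + c + transpose A *v y')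
      in (x, x', y',
          (1 - inverse (\<beta> k)) *\<^sub>R xbar + inverse (\<beta> k) *\<^sub>R x',
          (1 - inverse (\<beta> k)) *\<^sub>R ybar + inverse (\<beta> k) *\<^sub>R y'))"

primrec apdhg ::
  "real^'n^'n \<Rightarrow> real^'n^'m \<Rightarrow> real^'m \<Rightarrow> real^'n \<Rightarrow>
   (nat \<Rightarrow> real) \<Rightarrow> (nat \<Rightarrow> real) \<Rightarrow> (nat \<Rightarrow> real) \<Rightarrow> (nat \<Rightarrow> real) \<Rightarrow>
   (real^'n) \<times> (real^'m) \<Rightarrow> nat \<Rightarrow>
   (real^'n) \<times> (real^'n) \<times> (real^'m) \<times> (real^'n) \<times> (real^'m)" where
  "apdhg Q A b c \<beta> \<theta> \<eta> \<tau> z0 0 = (fst z0, fst z0, snd z0, fst z0, snd z0)"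
| "apdhg Q A b c \<beta> \<theta> \<eta> \<tau> z0 (Suc k) =
     apdhg_step Q A b c \<beta> \<theta> \<eta> \<tau> k (apdhg Q A b c \<beta> \<theta> \<eta> \<tau> z0 k)"

definition apdhg_average ::
  "real^'n^'n \<Rightarrow> real^'n^'m \<Rightarrow> real^'m \<Rightarrow> real^'n \<Rightarrow>
   (nat \<Rightarrow> real) \<Rightarrow> (nat \<Rightarrow> real) \<Rightarrow> (nat \<Rightarrow> real) \<Rightarrow> (nat \<Rightarrow> real) \<Rightarrow>
   (real^'n) \<times> (real^'m) \<Rightarrow> nat \<Rightarrow> (real^'n) \<times> (real^'m)" where
  "apdhg_average Q A b c \<beta> \<theta> \<eta> \<tau> z0 k =
     (case apdhg Q A b c \<beta> \<theta> \<eta> \<tau> z0 k of (xprev, x, y, xbar, ybar) \<Rightarrow> (xbar, ybar))"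

text \<open>\<open>rapdhg \<dots> K z0 n\<close> is the \<open>n\<close>-th restart point.\<close>

primrec rapdhg ::
  "real^'n^'n \<Rightarrow> real^'n^'m \<Rightarrow> real^'m \<Rightarrow> real^'n \<Rightarrow>
   (nat \<Rightarrow> real) \<Rightarrow> (nat \<Rightarrow> real) \<Rightarrow> (nat \<Rightarrow> real) \<Rightarrow> (nat \<Rightarrow> real) \<Rightarrow>
   nat \<Rightarrow> (real^'n) \<times> (real^'m) \<Rightarrow> nat \<Rightarrow> (real^'n) \<times> (real^'m)" where
  "rapdhg Q A b c \<beta> \<theta> \<eta> \<tau> K z0 0 = z0"
| "rapdhg Q A b c \<beta> \<theta> \<eta> \<tau> K z0 (Suc n) =
     apdhg_average Q A b c \<beta> \<theta> \<eta> \<tau> (rapdhg Q A b c \<beta> \<theta> \<eta> \<tau> K z0 n) K"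

lemma closed_feasible: "closed (feasible :: ((real^'n) \<times> (real^'m)) set)"
proof -
  have "nonneg_orthant = (\<Inter>i. {y::real^'m. 0 \<le> y $ i})"
    by (auto simp: nonneg_orthant_def)
  moreover have "closed {y::real^'m. 0 \<le> y $ i}" for i
    by (intro closed_Collect_le continuous_intros)
  ultimately have "closed (nonneg_orthant :: (real^'m) set)"
    by (metis closed_INT)
  then show ?thesis unfolding feasible_def by (intro closed_Times closed_UNIV)
qed

lemma continuous_lagrangian [continuous_intros]:
  fixes f :: "'a::topological_space \<Rightarrow> real^'n" and g :: "'a \<Rightarrow> real^'m"
  assumes "continuous_on S f" "continuous_on S g"
  shows "continuous_on S (\<lambda>z. lagrangian Q A b c (f z) (g z))"
proof -
  have mv: "continuous_on S (\<lambda>z. M *v f z)" for M :: "real^'n^'k"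
    using continuous_on_compose2[OF matrix_vector_mult_linear_continuous_on[of UNIV M] assms(1)]
    by simp
  show ?thesis
    unfolding lagrangian_def by (intro continuous_intros assms mv)
qed

lemma closed_saddle_points: "closed (saddle_points Q A b c)"
proof -
  have eq: "saddle_points Q A b c = feasible \<inter> (\<Inter>w\<in>feasible.
      {z. lagrangian Q A b c (fst z) (snd w) \<le> lagrangian Q A b c (fst z) (snd z)} \<inter>
      {z. lagrangian Q A b c (fst z) (snd z) \<le> lagrangian Q A b c (fst w) (snd z)})"
    unfolding saddle_points_def by (fastforce simp: case_prod_beta)
  show ?thesis
    unfolding eq
    by (intro closed_Int closed_feasible closed_INT ballI closed_Collect_le continuous_intros)
qed

lemma dist_saddle_points_attained:
  assumes "saddle_points Q A b c \<noteq> {}"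
  shows "\<exists>zs \<in> saddle_points Q A b c. infdist z (saddle_points Q A b c) = dist z zs"
  using infdist_attains_inf[OF closed_saddle_points assms] by metis

lemma smoothed_gap_attained:
  fixes Q :: "real^'n^'n" and A :: "real^'n^'m"
  assumes Q: "sym_psd Q" and \<xi>: "\<xi> > 0" and zd: "zd \<in> feasible"
  shows "\<exists>w \<in> feasible. gap_objective Q A b c \<xi> z zd w = smoothed_gap Q A b c \<xi> z zd \<and>
           (\<forall>w' \<in> feasible. gap_objective Q A b c \<xi> z zd w' \<le> gap_objective Q A b c \<xi> z zd w)"
proof -
  let ?f = "gap_objective Q A b c \<xi> z zd"
  define x y where "x = fst z" and "y = snd z"
  define v where "v = (- (c + transpose A *v y), A *v x - b)"
  define C where "C = 1/2 * (x \<bullet> (Q *v x)) + c \<bullet> x + b \<bullet> y + v \<bullet> zd"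
  define r where "r = 1 + (norm v + \<bar>C - ?f zd\<bar>) * (2 / \<xi>)"
  have r1: "r \<ge> 1" using \<xi> unfolding r_def by simp
  have bound: "?f w \<le> C + norm v * norm (w - zd) - \<xi> / 2 * (norm (w - zd))\<^sup>2" for w
  proof -
    have t: "y \<bullet> (A *v fst w) = (transpose A *v y) \<bullet> fst w"
      by (simp add: dot_lmul_matrix)
    have "v \<bullet> w = - (c \<bullet> fst w) - y \<bullet> (A *v fst w) + (A *v x) \<bullet> snd w - b \<bullet> snd w"
      unfolding t by (simp add: v_def inner_prod_def inner_add_left inner_diff_left)
    then have "?f w = 1/2 * (x \<bullet> (Q *v x)) + c \<bullet> x + b \<bullet> y + v \<bullet> w
                  - 1/2 * (fst w \<bullet> (Q *v fst w)) - \<xi> / 2 * (norm (w - zd))\<^sup>2"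
      unfolding gap_objective_def lagrangian_def x_def y_def
      by (simp add: inner_commute)
    moreover have "0 \<le> fst w \<bullet> (Q *v fst w)" using Q unfolding sym_psd_def by blast
    moreover have "v \<bullet> w = v \<bullet> zd + v \<bullet> (w - zd)" by (simp add: inner_diff_right)
    moreover have "v \<bullet> (w - zd) \<le> norm v * norm (w - zd)" by (rule norm_cauchy_schwarz)
    ultimately show ?thesis unfolding C_def by linarith
  qed
  have far: "?f w \<le> ?f zd" if "norm (w - zd) \<ge> r" for w
  proof -
    let ?t = "norm (w - zd)"
    have t1: "?t \<ge> 1" using that r1 by linarith
    have "norm v + \<bar>C - ?f zd\<bar> \<le> \<xi> / 2 * r"
      using \<xi> unfolding r_def by (simp add: field_simps)
    also have "\<dots> \<le> \<xi> / 2 * ?t" using that \<xi> by simp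
    finally have "(norm v + \<bar>C - ?f zd\<bar>) * ?t \<le> \<xi> / 2 * ?t * ?t"
      by (rule mult_right_mono) simp
    moreover have "\<bar>C - ?f zd\<bar> \<le> \<bar>C - ?f zd\<bar> * ?t" using t1 mult_left_mono[of 1 ?t "\<bar>C - ?f zd\<bar>"] by simp
    ultimately have "norm v * ?t + \<bar>C - ?f zd\<bar> \<le> \<xi> / 2 * ?t\<^sup>2"
      by (simp add: algebra_simps power2_eq_square)
    then show ?thesis using bound[of w] by linarith
  qed
  have "compact (feasible \<inter> cball zd r)"
    by (simp add: closed_Int_compact closed_feasible)
  moreover have "feasible \<inter> cball zd r \<noteq> {}" using zd r1 by auto
  moreover have "continuous_on (feasible \<inter> cball zd r) ?f"
    unfolding gap_objective_def[abs_def] by (intro continuous_intros)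
  ultimately obtain w where w: "w \<in> feasible \<inter> cball zd r"
    and max: "\<And>w'. w' \<in> feasible \<inter> cball zd r \<Longrightarrow> ?f w' \<le> ?f w"
    using continuous_attains_sup[of "feasible \<inter> cball zd r" ?f] by blast
  have all: "?f w' \<le> ?f w" if "w' \<in> feasible" for w'
  proof (cases "norm (w' - zd) \<le> r")
    case True
    then show ?thesis using max[of w'] that by (simp add: dist_norm norm_minus_commute)
  next
    case False
    then have "?f w' \<le> ?f zd" using far by simp
    also have "\<dots> \<le> ?f w" using max[of zd] zd r1 by simp
    finally show ?thesis .
  qed
  have "smoothed_gap Q A b c \<xi> z zd = ?f w"
    unfolding smoothed_gap_def using w all by (intro cSup_eq_maximum) auto
  then show ?thesis using w all by auto
qed

end

theory Submission
  imports Defs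
begin

text \<open>
  Within one restart period, an energy that combines the weighted primal-dual gap with the squared
  distance to an arbitrary comparison point \<open>w\<close> is nonincreasing, for every feasible \<open>w\<close>.
  Taking for \<open>w\<close> the saddle point nearest to the start, where the gap is nonnegative, confines all
  iterates to a ball of twice the distance to that point, so consecutive restart points are at
  most three times that distance apart.  Taking \<open>w\<close> arbitrary bounds the smoothed gap of the
  average by a multiple of the squared distance, which quadratic growth turns into a contraction
  by the factor \<open>1/e\<close>.  Growth is only assumed on a ball around the first start, and the iterates
  stay there because the displacements form a geometric series.
\<close>

section \<open>Spectral norm estimates and the geometry of the feasible set\<close>

lemma norm_matrix_vector_le:
  fixes M :: "real^'n^'m"
  shows "norm (M *v v) \<le> spectral_norm M * norm v"
  by (rule onorm) (rule matrix_vector_mul_bounded_linear)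

lemma spectral_norm_nonneg: "0 \<le> spectral_norm (M :: real^'n^'m)"
  by (rule onorm_pos_le) (rule matrix_vector_mul_bounded_linear)

lemma spectral_norm_pos:
  fixes M :: "real^'n^'m"
  assumes "M \<noteq> 0"
  shows "0 < spectral_norm M"
proof -
  have "\<exists>v. M *v v \<noteq> 0"
    using assms by (metis matrix_eq matrix_vector_mult_0)
  then show ?thesis
    by (simp add: onorm_pos_lt[OF matrix_vector_mul_bounded_linear])
qed

lemma nonneg_orthant_closed_convex_nonempty:
  shows "closed (nonneg_orthant :: (real^'m) set)"
    and "convex (nonneg_orthant :: (real^'m) set)"
    and "(nonneg_orthant :: (real^'m) set) \<noteq> {}"
proof -
  have eq: "nonneg_orthant = (\<Inter>i. {y::real^'m. 0 \<le> y $ i})"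
    by (auto simp: nonneg_orthant_def)
  have "closed {y::real^'m. 0 \<le> y $ i}" for i
    by (intro closed_Collect_le continuous_intros)
  then show "closed (nonneg_orthant :: (real^'m) set)"
    unfolding eq by (intro closed_INT) auto
  show "convex (nonneg_orthant :: (real^'m) set)"
    by (auto simp: convex_def nonneg_orthant_def)
  show "(nonneg_orthant :: (real^'m) set) \<noteq> {}"
    by (auto simp: nonneg_orthant_def intro!: exI[of _ 0])
qed

lemma convex_feasible: "convex (feasible :: ((real^'n) \<times> (real^'m)) set)"
  unfolding feasible_def
  by (intro convex_Times nonneg_orthant_closed_convex_nonempty convex_UNIV)

section \<open>Accelerated descent for the quadratic objective\<close>

lemma quadratic_expansion:
  fixes Q :: "real^'n^'n"
  assumes "transpose Q = Q"
  shows "1/2 * (w \<bullet> (Q *v w)) + c \<bullet> w = 1/2 * (u \<bullet> (Q *v u)) + c \<bullet> u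
           + (Q *v u + c) \<bullet> (w - u) + 1/2 * ((w - u) \<bullet> (Q *v (w - u)))"
proof -
  have "u \<bullet> (Q *v w) = w \<bullet> (Q *v u)"
    by (metis assms dot_lmul_matrix inner_commute vector_transpose_matrix)
  then show ?thesis
    by (simp add: matrix_vector_mult_diff_distrib inner_diff_left inner_diff_right
        inner_add_left inner_add_right inner_commute field_simps)
qed

text \<open>The exact Taylor expansion at the extrapolated point \<open>m\<close> bounds
  \<open>f xb'\<close> from above, while convexity bounds \<open>f xb\<close> and \<open>f w\<close>
  from below by the linearization at \<open>m\<close>, which splits along the convex combination
  defining \<open>xb'\<close>. The gradient term in \<open>x' - w\<close> is left for the update
  rule of \<open>x'\<close> to absorb.\<close>

lemma accelerated_descent:
  fixes Q :: "real^'n^'n" and c :: "real^'n" and t :: real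
  assumes Q: "sym_psd Q" and t: "0 \<le> t" "t \<le> 1"
    and m: "m = (1 - t) *\<^sub>R xb + t *\<^sub>R x"
    and xb': "xb' = (1 - t) *\<^sub>R xb + t *\<^sub>R x'"
  defines "f \<equiv> \<lambda>x. 1/2 * (x \<bullet> (Q *v x)) + c \<bullet> x"
  shows "f xb' \<le> (1 - t) * f xb + t * (f w + (Q *v m + c) \<bullet> (x' - w))
           + t\<^sup>2 * spectral_norm Q / 2 * (norm (x' - x))\<^sup>2"
proof -
  define g where "g = Q *v m + c"
  have sym: "transpose Q = Q" and psd: "\<And>v. 0 \<le> v \<bullet> (Q *v v)"
    using Q unfolding sym_psd_def by auto
  have exp: "f v = f m + g \<bullet> (v - m) + 1/2 * ((v - m) \<bullet> (Q *v (v - m)))" for v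
    unfolding f_def g_def by (rule quadratic_expansion[OF sym])
  have lower: "f m + g \<bullet> (v - m) \<le> f v" for v
    using exp[of v] psd[of "v - m"] by simp
  \<comment> \<open>\<open>m\<close> and \<open>xb'\<close> share their \<open>xb\<close> part; this
    is where the factor \<open>t\<^sup>2\<close> in the error comes from.\<close>
  have d: "xb' - m = t *\<^sub>R (x' - x)"
    unfolding m xb' by (simp add: algebra_simps)
  have "(x' - x) \<bullet> (Q *v (x' - x)) \<le> norm (x' - x) * (spectral_norm Q * norm (x' - x))"
    by (rule order_trans[OF norm_cauchy_schwarz]) (intro mult_left_mono norm_matrix_vector_le norm_ge_zero)
  then have "t\<^sup>2 * ((x' - x) \<bullet> (Q *v (x' - x))) \<le> t\<^sup>2 * (spectral_norm Q * (norm (x' - x))\<^sup>2)"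
    by (intro mult_left_mono) (simp_all add: power2_eq_square mult_ac)
  moreover have "(xb' - m) \<bullet> (Q *v (xb' - m)) = t\<^sup>2 * ((x' - x) \<bullet> (Q *v (x' - x)))"
    unfolding d by (simp add: matrix_vector_mult_scaleR power2_eq_square)
  ultimately have up: "f xb' \<le> f m + g \<bullet> (xb' - m) + t\<^sup>2 * spectral_norm Q / 2 * (norm (x' - x))\<^sup>2"
    using exp[of xb'] by simp
  have "(1 - t) * (f m + g \<bullet> (xb - m)) \<le> (1 - t) * f xb"
    using t by (intro mult_left_mono lower) simp
  moreover have "t * (f m + g \<bullet> (w - m)) \<le> t * f w"
    using t by (intro mult_left_mono lower) simp
  moreover have "g \<bullet> (xb' - m) = (1 - t) * (g \<bullet> (xb - m)) + t * (g \<bullet> (w - m)) + t * (g \<bullet> (x' - w))"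
    unfolding xb' by (simp add: inner_diff_right inner_add_right algebra_simps)
  ultimately show ?thesis
    using up unfolding g_def[symmetric] by (simp add: algebra_simps)
qed

section \<open>Energy of one restart period\<close>

definition primal_dual_gap ::
  "real^'n^'n \<Rightarrow> real^'n^'m \<Rightarrow> real^'m \<Rightarrow> real^'n \<Rightarrow>
   (real^'n) \<times> (real^'m) \<Rightarrow> (real^'n) \<times> (real^'m) \<Rightarrow> real" where
  "primal_dual_gap Q A b c z w =
     lagrangian Q A b c (fst z) (snd w) - lagrangian Q A b c (fst w) (snd z)"

text \<open>
  The bilinear term is what the extrapolation leaves over after telescoping; the last term is the
  part of the descent that pays for it.
\<close>

fun apdhg_energy ::
  "real^'n^'n \<Rightarrow> real^'n^'m \<Rightarrow> real^'m \<Rightarrow> real^'n \<Rightarrow> nat \<Rightarrow> (real^'n) \<times> (real^'m) \<Rightarrow> nat \<Rightarrow>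
   (real^'n) \<times> (real^'n) \<times> (real^'m) \<times> (real^'n) \<times> (real^'m) \<Rightarrow> real" where
  "apdhg_energy Q A b c K w k (xprev, x, y, xbar, ybar) =
     real k * (real k + 1) / 2 * primal_dual_gap Q A b c (xbar, ybar) w
     + (spectral_norm Q + real K * spectral_norm A) * (norm (x - fst w))\<^sup>2
     + real K * spectral_norm A * (norm (y - snd w))\<^sup>2
     - real k * ((A *v (x - xprev)) \<bullet> (snd w - y))
     + real K * spectral_norm A * (norm (x - xprev))\<^sup>2"

lemma inner_three_point:
  fixes u v w :: "'a::real_inner"
  shows "2 * ((u - v) \<bullet> (v - w)) = (norm (u - w))\<^sup>2 - (norm (v - w))\<^sup>2 - (norm (v - u))\<^sup>2"
  by (simp add: power2_norm_eq_inner inner_diff_left inner_diff_right inner_commute)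

text \<open>Serves to replace the step-dependent weight \<open>s\<close> of a bilinear term by the
  uniform weight \<open>S\<close>, the restart length. The inner product may be negative, so the
  estimate passes through its absolute value.\<close>

lemma matrix_inner_le:
  fixes A :: "real^'n^'m" and s :: real
  assumes "0 \<le> s" "s \<le> S"
  shows "s * ((A *v u) \<bullet> v) \<le> S * spectral_norm A * (norm u * norm v)"
proof -
  have "s * ((A *v u) \<bullet> v) \<le> s * \<bar>(A *v u) \<bullet> v\<bar>"
    using assms by (intro mult_left_mono) auto
  also have "\<dots> \<le> S * ((spectral_norm A * norm u) * norm v)"
    using assms by (intro mult_mono order_trans[OF Cauchy_Schwarz_ineq2]
        mult_right_mono norm_matrix_vector_le) auto
  finally show ?thesis by (simp add: mult_ac)
qed

text \<open>Weighting the descent inequality by \<open>n * (n + 1) / 2\<close>, with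
  \<open>n = k + 1\<close>, makes the gaps telescope, and the two update rules turn the remaining
  inner products into differences of squared distances. Of the negative term
  \<open>(q + K * a) * (norm (x' - x))\<^sup>2\<close> the \<open>q\<close> part pays for the
  smoothness error, and the rest is stored in the new energy to pay for the cross term of the next
  step.\<close>

lemma apdhg_energy_step:
  fixes Q :: "real^'n^'n" and A :: "real^'n^'m"
  assumes Q: "sym_psd Q" and A: "A \<noteq> 0" and w: "w \<in> feasible" and k: "k < K"
    and \<beta>: "\<beta> k = (real k + 2) / 2"
    and \<theta>: "\<theta> k = real k / (real k + 1)"
    and \<eta>: "\<eta> k = (real k + 1) / (2 * (spectral_norm Q + real K * spectral_norm A))"
    and \<tau>: "\<tau> k = (real k + 1) / (2 * real K * spectral_norm A)"
  shows "apdhg_energy Q A b c K w (Suc k) (apdhg_step Q A b c \<beta> \<theta> \<eta> \<tau> k s)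
           \<le> apdhg_energy Q A b c K w k s"
proof -
  obtain xp x y xb yb where s: "s = (xp, x, y, xb, yb)"
    by (metis prod_cases5)
  obtain xw yw where w_eq: "w = (xw, yw)" by fastforce
  define q a where "q = spectral_norm Q" and "a = spectral_norm A"
  define t where "t = inverse (\<beta> k)"
  define m where "m = (1 - t) *\<^sub>R xb + t *\<^sub>R x"
  define v where "v = \<theta> k *\<^sub>R (x - xp) + x"
  define p where "p = y + \<tau> k *\<^sub>R (A *v v - b)"
  define y' where "y' = closest_point nonneg_orthant p"
  define g where "g = Q *v m + c"
  define x' where "x' = x - \<eta> k *\<^sub>R (g + transpose A *v y')"
  define xb' where "xb' = (1 - t) *\<^sub>R xb + t *\<^sub>R x'"
  define yb' where "yb' = (1 - t) *\<^sub>R yb + t *\<^sub>R y'"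
  define f where "f = (\<lambda>x. 1/2 * (x \<bullet> (Q *v x)) + c \<bullet> x)"
  define n where "n = real k + 1"
  have step: "apdhg_step Q A b c \<beta> \<theta> \<eta> \<tau> k s = (x, x', y', xb', yb')"
    unfolding s x'_def xb'_def yb'_def y'_def g_def m_def t_def p_def v_def
    by (simp add: Let_def)
  have q: "0 \<le> q" unfolding q_def by (rule spectral_norm_nonneg)
  have a: "0 < a" unfolding a_def using A by (rule spectral_norm_pos)
  have Kpos: "0 < real K" using k by simp
  have Ka: "0 < real K * a" using a Kpos by simp
  have n: "1 \<le> n" "real k = n - 1" unfolding n_def by auto
  have kn: "real (Suc k) = n" unfolding n_def by simp
  \<comment> \<open>With this value the weight \<open>n * (n + 1) / 2\<close> splits into the
    previous weight \<open>(n - 1) * n / 2\<close> on the old average and \<open>n\<close> on the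
    new iterate.\<close>
  have t: "t = 2 / (n + 1)" unfolding t_def \<beta> n_def by (simp add: field_simps)
  have t01: "0 \<le> t" "t \<le> 1" using n unfolding t by auto

  \<comment> \<open>An equality, since the \<open>x\<close> update is unconstrained. The step size
    satisfies \<open>2 * (q + K * a) * \<eta> k = n\<close>, so the distances carry a weight
    independent of \<open>k\<close>.\<close>
  have primal: "n * ((g + transpose A *v y') \<bullet> (x' - xw)) =
      (q + real K * a) * ((norm (x - xw))\<^sup>2 - (norm (x' - xw))\<^sup>2 - (norm (x' - x))\<^sup>2)"
  proof -
    have "x - x' = \<eta> k *\<^sub>R (g + transpose A *v y')" unfolding x'_def by simp
    moreover have "2 * (q + real K * a) * \<eta> k = n"
      using q Ka unfolding \<eta> n_def q_def a_def by (simp add: field_simps)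
    ultimately have "n *\<^sub>R (g + transpose A *v y') = (2 * (q + real K * a)) *\<^sub>R (x - x')"
      by simp
    then have "n * ((g + transpose A *v y') \<bullet> (x' - xw)) = (q + real K * a) * (2 * ((x - x') \<bullet> (x' - xw)))"
      by (metis (no_types, opaque_lifting) inner_scaleR_left mult.assoc mult.commute)
    then show ?thesis unfolding inner_three_point .
  qed

  \<comment> \<open>Only an inequality: it is the variational characterization of the projection,
    tested with the feasible point \<open>yw\<close>.\<close>
  have dual: "n * ((A *v v - b) \<bullet> (yw - y')) \<le>
      real K * a * ((norm (y - yw))\<^sup>2 - (norm (y' - yw))\<^sup>2 - (norm (y' - y))\<^sup>2)"
  proof -
    have "yw \<in> nonneg_orthant" using w unfolding w_eq feasible_def by simp
    then have "(p - y') \<bullet> (yw - y') \<le> 0"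
      unfolding y'_def
      by (intro closest_point_dot nonneg_orthant_closed_convex_nonempty)
    then have "\<tau> k * ((A *v v - b) \<bullet> (yw - y')) \<le> (y - y') \<bullet> (y' - yw)"
      unfolding p_def by (simp add: inner_diff_left inner_diff_right inner_add_left algebra_simps)
    then have "2 * (real K * a) * (\<tau> k * ((A *v v - b) \<bullet> (yw - y'))) \<le>
        2 * (real K * a) * ((y - y') \<bullet> (y' - yw))"
      by (rule mult_left_mono) (use Ka in simp)
    then have "2 * (real K * a) * (\<tau> k * ((A *v v - b) \<bullet> (yw - y'))) \<le>
        real K * a * (2 * ((y - y') \<bullet> (y' - yw)))"
      by (simp only: mult_ac)
    moreover have "2 * (real K * a) * \<tau> k = n"
      using a Kpos unfolding \<tau> n_def a_def by (simp add: field_simps)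
    ultimately show ?thesis unfolding inner_three_point by (metis mult.assoc)
  qed

  have descent: "n * (n + 1) / 2 * f xb' \<le> (n - 1) * n / 2 * f xb + n * (f xw + g \<bullet> (x' - xw))
      + q * (norm (x' - x))\<^sup>2"
  proof -
    have "f xb' \<le> (1 - t) * f xb + t * (f xw + g \<bullet> (x' - xw)) + t\<^sup>2 * q / 2 * (norm (x' - x))\<^sup>2"
      unfolding f_def g_def q_def
      by (rule accelerated_descent[OF Q t01]) (simp_all add: m_def xb'_def)
    then have "n * (n + 1) / 2 * f xb' \<le> n * (n + 1) / 2 *
        ((1 - t) * f xb + t * (f xw + g \<bullet> (x' - xw)) + t\<^sup>2 * q / 2 * (norm (x' - x))\<^sup>2)"
      using n by (intro mult_left_mono) auto
    also have "\<dots> = (n * (n + 1) / 2 * (1 - t)) * f xb + (n * (n + 1) / 2 * t) * (f xw + g \<bullet> (x' - xw))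
        + (n * (n + 1) / 2 * (t\<^sup>2 / 2)) * (q * (norm (x' - x))\<^sup>2)"
      by (simp add: field_simps)
    also have "n * (n + 1) / 2 * (1 - t) = (n - 1) * n / 2"
      using n unfolding t by (simp add: field_simps)
    also have "n * (n + 1) / 2 * t = n"
      using n unfolding t by (simp add: field_simps)
    also have "n * (n + 1) / 2 * (t\<^sup>2 / 2) = n / (n + 1)"
      using n(1) unfolding t power2_eq_square by (simp add: divide_simps)
    also have "n / (n + 1) * (q * (norm (x' - x))\<^sup>2) \<le> 1 * (q * (norm (x' - x))\<^sup>2)"
      using n q by (intro mult_right_mono) auto
    finally show ?thesis by simp
  qed

  \<comment> \<open>The part of the gap that is affine in \<open>(x, y)\<close>; averaging therefore
    acts on it exactly, whereas the quadratic part needs convexity.\<close>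
  define B where "B = (\<lambda>x y. (A *v x - b) \<bullet> yw - (A *v xw - b) \<bullet> y)"
  have gap: "primal_dual_gap Q A b c (x1, y1) w = f x1 - f xw + B x1 y1" for x1 y1
    unfolding primal_dual_gap_def lagrangian_def w_eq f_def B_def
    by (simp add: inner_diff_left inner_diff_right inner_commute)
  have bil: "n * (n + 1) / 2 * B xb' yb' = (n - 1) * n / 2 * B xb yb + n * B x' y'"
  proof -
    have "B xb' yb' = (1 - t) * B xb yb + t * B x' y'"
      unfolding B_def xb'_def yb'_def
      by (simp add: matrix_vector_right_distrib matrix_vector_mult_scaleR inner_add_left
          inner_diff_left inner_add_right inner_diff_right algebra_simps)
    then have "n * (n + 1) / 2 * B xb' yb' = n * (n + 1) / 2 * (1 - t) * B xb yb + n * (n + 1) / 2 * t * B x' y'"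
      by (simp only: distrib_left mult.assoc)
    also have "n * (n + 1) / 2 * (1 - t) = (n - 1) * n / 2"
      using n unfolding t by (simp add: field_simps)
    also have "n * (n + 1) / 2 * t = n"
      using n unfolding t by (simp add: field_simps)
    finally show ?thesis .
  qed
  \<comment> \<open>The final linear arithmetic, stated over plain variables so that the large terms
    stay opaque. Its six premises are the facts collected below.\<close>
  have combine: "G \<le> P + D + N4 - M1 + U + V + W"
    if "G \<le> N1 + N + W" "N = N2 + N3 + N4 - M1 - M2" "M3 \<le> U + V" "M2 = - M3" "N3 \<le> D" "N1 + N2 = P"
    for G P D N N1 N2 N3 N4 M1 M2 M3 U V W :: real
    using that by linarith
  have "n * (n + 1) / 2 * (f xb' - f xw + B xb' yb') - (n - 1) * n / 2 * (f xb - f xw + B xb yb)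
      \<le> n * (g \<bullet> (x' - xw)) + n * B x' y' + q * (norm (x' - x))\<^sup>2"
    using descent bil by (simp add: field_simps)
  \<comment> \<open>Since \<open>n * \<theta> k = n - 1\<close>, the error
    \<open>n * (x' - v)\<close> equals \<open>n * (x' - x) - (n - 1) * (x - xp)\<close>. Splitting
    \<open>yw - y'\<close> at \<open>y\<close> leaves two bilinear terms that telescope and one
    cross term.\<close>
  moreover have "n * B x' y' = n * ((transpose A *v y') \<bullet> (x' - xw)) + n * ((A *v v - b) \<bullet> (yw - y'))
      + n * ((A *v (x' - x)) \<bullet> (yw - y')) - (n - 1) * ((A *v (x - xp)) \<bullet> (yw - y))
      - (n - 1) * ((A *v (x - xp)) \<bullet> (y - y'))"
  proof -
    have th: "n * \<theta> k = n - 1" unfolding \<theta> n_def by simp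
    have tr: "(transpose A *v y') \<bullet> u = (A *v u) \<bullet> y'" for u
      by (metis dot_lmul_matrix inner_commute transpose_matrix_vector)
    have "n *\<^sub>R (A *v v) = n *\<^sub>R (A *v x) + (n - 1) *\<^sub>R (A *v (x - xp))"
      unfolding v_def
      by (simp add: matrix_vector_right_distrib matrix_vector_mult_scaleR scaleR_add_right th)
    then have "n * ((A *v v) \<bullet> (yw - y')) = n * ((A *v x) \<bullet> (yw - y')) + (n - 1) * ((A *v (x - xp)) \<bullet> (yw - y'))"
      by (metis inner_add_left inner_scaleR_left)
    moreover have "n * B x' y' = n * ((A *v (x' - xw)) \<bullet> y') + n * ((A *v x' - b) \<bullet> (yw - y'))"
      unfolding B_def
      by (simp add: matrix_vector_mult_diff_distrib inner_diff_left inner_diff_right algebra_simps)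
    ultimately show ?thesis unfolding tr
      by (simp add: matrix_vector_mult_diff_distrib inner_diff_left inner_diff_right algebra_simps)
  qed
  \<comment> \<open>The cross term is absorbed by the last term of the old energy and by the
    negative \<open>(norm (y' - y))\<^sup>2\<close> in \<open>dual\<close>; the weight satisfies
    \<open>n - 1 = k < K\<close>.\<close>
  moreover have "(n - 1) * ((A *v (x - xp)) \<bullet> (y' - y)) \<le>
      real K * a * (norm (x - xp))\<^sup>2 + real K * a * (norm (y' - y))\<^sup>2"
  proof -
    have "(n - 1) * ((A *v (x - xp)) \<bullet> (y' - y)) \<le> real K * a * (norm (x - xp) * norm (y' - y))"
      unfolding a_def using k n by (intro matrix_inner_le) auto
    also have "\<dots> \<le> real K * a * ((norm (x - xp))\<^sup>2 + (norm (y' - y))\<^sup>2)"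
    proof (rule mult_left_mono)
      show "norm (x - xp) * norm (y' - y) \<le> (norm (x - xp))\<^sup>2 + (norm (y' - y))\<^sup>2"
        using sum_squares_bound[of "norm (x - xp)" "norm (y' - y)"]
          mult_nonneg_nonneg[OF norm_ge_zero[of "x - xp"] norm_ge_zero[of "y' - y"]] by linarith
    qed (use Ka in simp)
    finally show ?thesis by (simp only: distrib_left)
  qed
  moreover have "(n - 1) * ((A *v (x - xp)) \<bullet> (y - y')) = - ((n - 1) * ((A *v (x - xp)) \<bullet> (y' - y)))"
    by (simp add: inner_diff_right algebra_simps)
  moreover note dual
  moreover have "n * (g \<bullet> (x' - xw)) + n * ((transpose A *v y') \<bullet> (x' - xw)) =
      (q + real K * a) * ((norm (x - xw))\<^sup>2 - (norm (x' - xw))\<^sup>2 - (norm (x' - x))\<^sup>2)"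
    using primal by (simp only: inner_add_left distrib_left)
  ultimately have "n * (n + 1) / 2 * (f xb' - f xw + B xb' yb') - (n - 1) * n / 2 * (f xb - f xw + B xb yb)
      \<le> (q + real K * a) * ((norm (x - xw))\<^sup>2 - (norm (x' - xw))\<^sup>2 - (norm (x' - x))\<^sup>2)
        + real K * a * ((norm (y - yw))\<^sup>2 - (norm (y' - yw))\<^sup>2 - (norm (y' - y))\<^sup>2)
        + n * ((A *v (x' - x)) \<bullet> (yw - y')) - (n - 1) * ((A *v (x - xp)) \<bullet> (yw - y))
        + real K * a * (norm (x - xp))\<^sup>2 + real K * a * (norm (y' - y))\<^sup>2 + q * (norm (x' - x))\<^sup>2"
    by - (rule combine; assumption)
  moreover have "apdhg_energy Q A b c K w (Suc k) (x, x', y', xb', yb') - apdhg_energy Q A b c K w k (xp, x, y, xb, yb)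
      = n * (n + 1) / 2 * (f xb' - f xw + B xb' yb') - (n - 1) * n / 2 * (f xb - f xw + B xb yb)
        - ((q + real K * a) * ((norm (x - xw))\<^sup>2 - (norm (x' - xw))\<^sup>2 - (norm (x' - x))\<^sup>2)
        + real K * a * ((norm (y - yw))\<^sup>2 - (norm (y' - yw))\<^sup>2 - (norm (y' - y))\<^sup>2)
        + n * ((A *v (x' - x)) \<bullet> (yw - y')) - (n - 1) * ((A *v (x - xp)) \<bullet> (yw - y))
        + real K * a * (norm (x - xp))\<^sup>2 + real K * a * (norm (y' - y))\<^sup>2 + q * (norm (x' - x))\<^sup>2)"
    unfolding apdhg_energy.simps gap kn n(2)
    unfolding w_eq fst_conv snd_conv q_def[symmetric] a_def[symmetric]
    by (simp only: diff_add_cancel) (simp add: ring_distribs)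
  ultimately show ?thesis
    unfolding step unfolding s by (metis diff_le_0_iff_le)
qed

text \<open>Young's inequality with weights 1 and 1/4: the bilinear term uses up the whole of the
  last energy term and a quarter of the dual distance, hence the 3/4.\<close>

lemma apdhg_energy_lower:
  assumes A: "A \<noteq> 0" and k: "k \<le> K"
  shows "real k * (real k + 1) / 2 * primal_dual_gap Q A b c (xbar, ybar) w
      + (spectral_norm Q + real K * spectral_norm A) * (norm (x - fst w))\<^sup>2
      + 3/4 * (real K * spectral_norm A) * (norm (y - snd w))\<^sup>2
    \<le> apdhg_energy Q A b c K w k (xprev, x, y, xbar, ybar)"
proof -
  define u v where "u = norm (x - xprev)" and "v = norm (snd w - y)"
  have a: "0 \<le> real K * spectral_norm A" by (simp add: spectral_norm_nonneg)
  have "real k * ((A *v (x - xprev)) \<bullet> (snd w - y)) \<le> real K * spectral_norm A * (u * v)"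
    unfolding u_def v_def using k by (intro matrix_inner_le) auto
  also have "\<dots> \<le> real K * spectral_norm A * (u\<^sup>2 + 1/4 * v\<^sup>2)"
  proof (rule mult_left_mono[OF _ a])
    have "0 \<le> (u - 1/2 * v)\<^sup>2" by simp
    then show "u * v \<le> u\<^sup>2 + 1/4 * v\<^sup>2" by (simp add: power2_eq_square algebra_simps)
  qed
  finally show ?thesis
    by (simp add: u_def v_def norm_minus_commute algebra_simps)
qed

section \<open>Bounds for the iterates and averages of one period\<close>

definition apdhg_iterate ::
  "real^'n^'n \<Rightarrow> real^'n^'m \<Rightarrow> real^'m \<Rightarrow> real^'n \<Rightarrow>
   (nat \<Rightarrow> real) \<Rightarrow> (nat \<Rightarrow> real) \<Rightarrow> (nat \<Rightarrow> real) \<Rightarrow> (nat \<Rightarrow> real) \<Rightarrow>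
   (real^'n) \<times> (real^'m) \<Rightarrow> nat \<Rightarrow> (real^'n) \<times> (real^'m)" where
  "apdhg_iterate Q A b c \<beta> \<theta> \<eta> \<tau> z0 k =
     (case apdhg Q A b c \<beta> \<theta> \<eta> \<tau> z0 k of (xprev, x, y, xbar, ybar) \<Rightarrow> (x, y))"

lemma apdhg_average_Suc:
  "apdhg_average Q A b c \<beta> \<theta> \<eta> \<tau> z0 (Suc k) =
     (1 - inverse (\<beta> k)) *\<^sub>R apdhg_average Q A b c \<beta> \<theta> \<eta> \<tau> z0 k
     + inverse (\<beta> k) *\<^sub>R apdhg_iterate Q A b c \<beta> \<theta> \<eta> \<tau> z0 (Suc k)"
  unfolding apdhg_average_def apdhg_iterate_def
  by (cases "apdhg Q A b c \<beta> \<theta> \<eta> \<tau> z0 k") (simp add: Let_def)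

lemma apdhg_iterate_Suc_feasible:
  "apdhg_iterate Q A b c \<beta> \<theta> \<eta> \<tau> z0 (Suc k) \<in> feasible"
  unfolding apdhg_iterate_def feasible_def
  by (cases "apdhg Q A b c \<beta> \<theta> \<eta> \<tau> z0 k")
    (simp add: Let_def closest_point_in_set nonneg_orthant_closed_convex_nonempty)

text \<open>Since \<open>\<beta> 0 = 1\<close>, the average does not involve the starting point, which may be infeasible.\<close>

lemma apdhg_average_in_convex:
  assumes S: "convex S"
    and \<beta>: "\<And>k. k < K \<Longrightarrow> \<beta> k = (real k + 2) / 2"
    and iter: "\<And>k. k < K \<Longrightarrow> apdhg_iterate Q A b c \<beta> \<theta> \<eta> \<tau> z0 (Suc k) \<in> S"
    and k: "k < K"
  shows "apdhg_average Q A b c \<beta> \<theta> \<eta> \<tau> z0 (Suc k) \<in> S"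
  using k
proof (induction k)
  case 0
  then show ?case using iter[of 0] \<beta>[of 0] unfolding apdhg_average_Suc by simp
next
  case (Suc k)
  have t: "0 \<le> inverse (\<beta> (Suc k))" "inverse (\<beta> (Suc k)) \<le> 1"
    using \<beta>[OF Suc.prems] by (auto simp: field_simps)
  show ?case
    unfolding apdhg_average_Suc[of _ _ _ _ _ _ _ _ _ "Suc k"]
    using t Suc.IH Suc.prems by (intro convexD[OF S] iter) auto
qed

text \<open>Telescopes the energy. At \<open>k = 0\<close> only the two distance terms survive: the
  gap and the bilinear term have weight zero, and the previous point is initialised to the
  start.\<close>

lemma apdhg_bound:
  fixes Q :: "real^'n^'n" and A :: "real^'n^'m"
  assumes Q: "sym_psd Q" and A: "A \<noteq> 0" and w: "w \<in> feasible"
    and \<beta>: "\<And>k. k < K \<Longrightarrow> \<beta> k = (real k + 2) / 2"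
    and \<theta>: "\<And>k. k < K \<Longrightarrow> \<theta> k = real k / (real k + 1)"
    and \<eta>: "\<And>k. k < K \<Longrightarrow> \<eta> k = (real k + 1) / (2 * (spectral_norm Q + real K * spectral_norm A))"
    and \<tau>: "\<And>k. k < K \<Longrightarrow> \<tau> k = (real k + 1) / (2 * real K * spectral_norm A)"
    and k: "k \<le> K"
  shows "real k * (real k + 1) / 2 * primal_dual_gap Q A b c (apdhg_average Q A b c \<beta> \<theta> \<eta> \<tau> z0 k) w
      + 3/4 * (real K * spectral_norm A) * (norm (apdhg_iterate Q A b c \<beta> \<theta> \<eta> \<tau> z0 k - w))\<^sup>2
    \<le> (spectral_norm Q + real K * spectral_norm A) * (norm (z0 - w))\<^sup>2"
proof -
  let ?q = "spectral_norm Q" and ?a = "real K * spectral_norm A"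
  have q: "0 \<le> ?q" and a: "0 \<le> ?a" by (simp_all add: spectral_norm_nonneg)
  have norm_pair: "(norm (u - w))\<^sup>2 = (norm (fst u - fst w))\<^sup>2 + (norm (snd u - snd w))\<^sup>2"
    for u :: "(real^'n) \<times> (real^'m)"
    by (simp add: norm_prod_def)
  have "apdhg_energy Q A b c K w k (apdhg Q A b c \<beta> \<theta> \<eta> \<tau> z0 k)
      \<le> (?q + ?a) * (norm (fst z0 - fst w))\<^sup>2 + ?a * (norm (snd z0 - snd w))\<^sup>2"
    using k
  proof (induction k)
    case 0
    show ?case by (simp del: prod.collapse)
  next
    case (Suc k)
    have "k < K" using Suc.prems by simp
    then have "apdhg_energy Q A b c K w (Suc k) (apdhg Q A b c \<beta> \<theta> \<eta> \<tau> z0 (Suc k))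
        \<le> apdhg_energy Q A b c K w k (apdhg Q A b c \<beta> \<theta> \<eta> \<tau> z0 k)"
      unfolding apdhg.simps by (intro apdhg_energy_step Q A w \<beta> \<theta> \<eta> \<tau>)
    then show ?case using Suc by linarith
  qed
  also have "\<dots> \<le> (?q + ?a) * (norm (z0 - w))\<^sup>2"
    unfolding norm_pair using q by (simp add: algebra_simps)
  finally have en: "apdhg_energy Q A b c K w k (apdhg Q A b c \<beta> \<theta> \<eta> \<tau> z0 k) \<le> (?q + ?a) * (norm (z0 - w))\<^sup>2" .
  obtain xp x y xb yb where s: "apdhg Q A b c \<beta> \<theta> \<eta> \<tau> z0 k = (xp, x, y, xb, yb)"
    by (metis prod_cases5)
  \<comment> \<open>The primal weight is lowered to the dual one, so that both distances merge into
    a distance in the product space.\<close>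
  have "3/4 * ?a * (norm (x - fst w))\<^sup>2 \<le> (?q + ?a) * (norm (x - fst w))\<^sup>2"
    using q a by (intro mult_right_mono) auto
  then show ?thesis
    using order_trans[OF apdhg_energy_lower[OF A k] en[unfolded s]]
    unfolding apdhg_average_def apdhg_iterate_def s norm_pair
    by (simp add: distrib_left)
qed

lemma primal_dual_gap_saddle_nonneg:
  assumes "zs \<in> saddle_points Q A b c" "z \<in> feasible"
  shows "0 \<le> primal_dual_gap Q A b c z zs"
proof -
  obtain xs ys x y where eq: "zs = (xs, ys)" "z = (x, y)" by fastforce
  have "lagrangian Q A b c xs y \<le> lagrangian Q A b c xs ys"
    "lagrangian Q A b c xs ys \<le> lagrangian Q A b c x ys"
    using assms unfolding saddle_points_def eq by auto
  then show ?thesis unfolding primal_dual_gap_def eq by simp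
qed

lemma apdhg_average_near_saddle:
  fixes Q :: "real^'n^'n" and A :: "real^'n^'m"
  assumes Q: "sym_psd Q" and A: "A \<noteq> 0" and zs: "zs \<in> saddle_points Q A b c"
    and \<beta>: "\<And>k. k < K \<Longrightarrow> \<beta> k = (real k + 2) / 2"
    and \<theta>: "\<And>k. k < K \<Longrightarrow> \<theta> k = real k / (real k + 1)"
    and \<eta>: "\<And>k. k < K \<Longrightarrow> \<eta> k = (real k + 1) / (2 * (spectral_norm Q + real K * spectral_norm A))"
    and \<tau>: "\<And>k. k < K \<Longrightarrow> \<tau> k = (real k + 1) / (2 * real K * spectral_norm A)"
    and K: "K \<ge> 1" "spectral_norm Q \<le> real K * spectral_norm A"
  shows "norm (apdhg_average Q A b c \<beta> \<theta> \<eta> \<tau> z0 K - zs) \<le> 2 * norm (z0 - zs)"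
proof -
  let ?av = "apdhg_average Q A b c \<beta> \<theta> \<eta> \<tau> z0" and ?it = "apdhg_iterate Q A b c \<beta> \<theta> \<eta> \<tau> z0"
  let ?a = "real K * spectral_norm A"
  have a: "0 < ?a" using K spectral_norm_pos[OF A] by simp
  have zs': "zs \<in> feasible" using zs unfolding saddle_points_def by auto
  have "?it (Suc k) \<in> cball zs (2 * norm (z0 - zs))" if k: "k < K" for k
  proof -
    have "?av (Suc k) \<in> feasible"
      by (rule apdhg_average_in_convex[OF convex_feasible \<beta> apdhg_iterate_Suc_feasible k])
    then have "0 \<le> real (Suc k) * (real (Suc k) + 1) / 2 * primal_dual_gap Q A b c (?av (Suc k)) zs"
      by (intro mult_nonneg_nonneg primal_dual_gap_saddle_nonneg[OF zs]) auto
    moreover have "(spectral_norm Q + ?a) * (norm (z0 - zs))\<^sup>2 \<le> 2 * ?a * (norm (z0 - zs))\<^sup>2"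
      using K by (intro mult_right_mono) auto
    moreover note apdhg_bound[OF Q A zs' \<beta> \<theta> \<eta> \<tau>, where k = "Suc k" and b = b and c = c and ?z0.0 = z0]
    ultimately have "3/4 * ?a * (norm (?it (Suc k) - zs))\<^sup>2 \<le> 2 * ?a * (norm (z0 - zs))\<^sup>2"
      using k by linarith
    then have "?a * (3/4 * (norm (?it (Suc k) - zs))\<^sup>2) \<le> ?a * (2 * (norm (z0 - zs))\<^sup>2)"
      by (simp only: mult_ac)
    then have "3/4 * (norm (?it (Suc k) - zs))\<^sup>2 \<le> 2 * (norm (z0 - zs))\<^sup>2"
      by (rule mult_left_le_imp_le[OF _ a])
    \<comment> \<open>The squared distances have ratio at most 8/3, which is below 4.\<close>
    moreover have "(2 * norm (z0 - zs))\<^sup>2 = 4 * (norm (z0 - zs))\<^sup>2"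
      by (simp add: power_mult_distrib)
    ultimately have "(norm (?it (Suc k) - zs))\<^sup>2 \<le> (2 * norm (z0 - zs))\<^sup>2"
      using zero_le_power2[of "norm (z0 - zs)"] by linarith
    then have "norm (?it (Suc k) - zs) \<le> 2 * norm (z0 - zs)"
      by (rule power2_le_imp_le) simp
    then show ?thesis by (simp add: dist_norm norm_minus_commute)
  qed
  then have "?av (Suc (K - 1)) \<in> cball zs (2 * norm (z0 - zs))"
    using K by (intro apdhg_average_in_convex[OF convex_cball \<beta>]) auto
  then show ?thesis using K by (simp add: dist_norm norm_minus_commute)
qed

text \<open>For each \<open>w\<close> the gap is at most \<open>C\<close> times the squared distance
  from \<open>z0\<close> to \<open>w\<close>. Splitting that distance at \<open>zd\<close> costs a
  factor 2, and the part depending on \<open>w\<close> is absorbed by the penalty because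
  \<open>2 * C \<le> \<xi> / 2\<close>.\<close>

lemma smoothed_gap_apdhg_average_le:
  fixes Q :: "real^'n^'n" and A :: "real^'n^'m"
  assumes Q: "sym_psd Q" and A: "A \<noteq> 0" and zd: "zd \<in> feasible"
    and \<beta>: "\<And>k. k < K \<Longrightarrow> \<beta> k = (real k + 2) / 2"
    and \<theta>: "\<And>k. k < K \<Longrightarrow> \<theta> k = real k / (real k + 1)"
    and \<eta>: "\<And>k. k < K \<Longrightarrow> \<eta> k = (real k + 1) / (2 * (spectral_norm Q + real K * spectral_norm A))"
    and \<tau>: "\<And>k. k < K \<Longrightarrow> \<tau> k = (real k + 1) / (2 * real K * spectral_norm A)"
    and K: "K \<ge> 1" and C: "2 * (spectral_norm Q + real K * spectral_norm A) \<le> C * (real K)\<^sup>2"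
    and \<xi>: "4 * C \<le> \<xi>"
  shows "smoothed_gap Q A b c \<xi> (apdhg_average Q A b c \<beta> \<theta> \<eta> \<tau> z0 K) zd \<le> 2 * C * (norm (z0 - zd))\<^sup>2"
  unfolding smoothed_gap_def
proof (rule cSUP_least)
  show "(feasible :: ((real^'n) \<times> (real^'m)) set) \<noteq> {}" using zd by auto
next
  fix w :: "(real^'n) \<times> (real^'m)" assume w: "w \<in> feasible"
  let ?z = "apdhg_average Q A b c \<beta> \<theta> \<eta> \<tau> z0 K"
  let ?P = "spectral_norm Q + real K * spectral_norm A"
  have P: "0 \<le> ?P" by (simp add: spectral_norm_nonneg)
  have K2: "0 < (real K)\<^sup>2" using K by simp
  have "0 \<le> C * (real K)\<^sup>2" by (rule order_trans[OF _ C]) (use P in simp)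
  then have C0: "0 \<le> C" using K2 by (simp add: zero_le_mult_iff)
  have gap_le: "primal_dual_gap Q A b c ?z w \<le> C * (norm (z0 - w))\<^sup>2"
  \<comment> \<open>Lowering the weight from \<open>K * (K + 1)\<close> to \<open>K\<^sup>2\<close>
    is sound only for a positive gap.\<close>
  proof (cases "primal_dual_gap Q A b c ?z w \<le> 0")
    case True
    then show ?thesis using C0 by (meson order_trans mult_nonneg_nonneg zero_le_power2)
  next
    case False
    have "(real K)\<^sup>2 * primal_dual_gap Q A b c ?z w \<le>
        2 * (real K * (real K + 1) / 2 * primal_dual_gap Q A b c ?z w)"
      using False by (simp add: power2_eq_square algebra_simps)
    also have "\<dots> \<le> 2 * ?P * (norm (z0 - w))\<^sup>2"
    proof -
      have "0 \<le> 3/4 * (real K * spectral_norm A) * (norm (apdhg_iterate Q A b c \<beta> \<theta> \<eta> \<tau> z0 K - w))\<^sup>2"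
        by (simp add: spectral_norm_nonneg)
      then show ?thesis using apdhg_bound[OF Q A w \<beta> \<theta> \<eta> \<tau> order_refl, where b = b and c = c and ?z0.0 = z0] by linarith
    qed
    also have "\<dots> \<le> C * (real K)\<^sup>2 * (norm (z0 - w))\<^sup>2"
      using C by (rule mult_right_mono) simp
    finally have "(real K)\<^sup>2 * primal_dual_gap Q A b c ?z w \<le> (real K)\<^sup>2 * (C * (norm (z0 - w))\<^sup>2)"
      by (simp only: mult_ac)
    then show ?thesis by (rule mult_left_le_imp_le[OF _ K2])
  qed
  have "(norm (z0 - w))\<^sup>2 \<le> (norm (z0 - zd) + norm (w - zd))\<^sup>2"
    by (rule power_mono) (use norm_triangle_ineq4[of "z0 - zd" "w - zd"] in simp_all)
  also have "\<dots> \<le> 2 * (norm (z0 - zd))\<^sup>2 + 2 * (norm (w - zd))\<^sup>2"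
    using sum_squares_bound[of "norm (z0 - zd)" "norm (w - zd)"] by (simp add: power2_sum)
  finally have "C * (norm (z0 - w))\<^sup>2 \<le> 2 * C * (norm (z0 - zd))\<^sup>2 + 2 * C * (norm (w - zd))\<^sup>2"
    using mult_left_mono[OF _ C0] by (fastforce simp: algebra_simps)
  moreover have "2 * C * (norm (w - zd))\<^sup>2 \<le> \<xi> / 2 * (norm (w - zd))\<^sup>2"
    using \<xi> by (intro mult_right_mono) auto
  ultimately show "gap_objective Q A b c \<xi> ?z zd w \<le> 2 * C * (norm (z0 - zd))\<^sup>2"
    using gap_le unfolding gap_objective_def primal_dual_gap_def by linarith
qed

section \<open>Restart length, contraction and confinement to the ball\<close>

text \<open>Each lower bound on \<open>K\<close> controls half of the right-hand side. Applied with
  \<delta> equal to \<open>\<alpha> / (8 * e\<^sup>2)\<close> and to \<open>\<xi> / 16\<close>, it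
  accounts for the constants 32 and 64 in the condition on \<open>K\<close>.\<close>

lemma restart_length_bound:
  fixes q a \<delta> :: real
  assumes "0 \<le> q" "0 \<le> a" "0 < \<delta>" "1 \<le> K"
    and "sqrt (4 * q / \<delta>) \<le> K" "4 * a / \<delta> \<le> K"
  shows "2 * (q + K * a) \<le> \<delta> * K\<^sup>2"
proof -
  have "4 * q / \<delta> \<le> K\<^sup>2"
    using assms by (metis real_sqrt_le_iff real_sqrt_abs abs_of_nonneg le_numeral_extra(1) order_trans zero_le_one)
  then have "4 * q \<le> \<delta> * K\<^sup>2"
    using assms by (simp add: field_simps)
  moreover have "4 * a \<le> \<delta> * K" using assms by (simp add: field_simps)
  then have "K * (4 * a) \<le> K * (\<delta> * K)" using assms by (intro mult_left_mono) auto
  ultimately show ?thesis by (simp add: power2_eq_square algebra_simps)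
qed

theorem theorem1:
  fixes Q :: "real^'n^'n" and A :: "real^'n^'m" and b :: "real^'m" and c :: "real^'n"
    and z0 :: "(real^'n) \<times> (real^'m)" and K :: nat and \<xi> \<alpha> R :: real
    and \<beta> \<theta> \<eta> \<tau> :: "nat \<Rightarrow> real"
  assumes Q: "sym_psd Q"
    and A: "A \<noteq> 0"
    and saddle: "saddle_points Q A b c \<noteq> {}"
    and K: "K \<ge> 1"
    and \<beta>: "\<And>k. k < K \<Longrightarrow> \<beta> k = (real k + 2) / 2"
    and \<theta>: "\<And>k. k < K \<Longrightarrow> \<theta> k = real k / (real k + 1)"
    and \<eta>: "\<And>k. k < K \<Longrightarrow> \<eta> k = (real k + 1) / (2 * (spectral_norm Q + real K * spectral_norm A))"
    and \<tau>: "\<And>k. k < K \<Longrightarrow> \<tau> k = (real k + 1) / (2 * real K * spectral_norm A)"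
    and \<xi>: "\<xi> > 0"
    and \<alpha>: "\<alpha> > 0"
    and R: "R = 3 / (1 - 1 / exp 1) * infdist z0 (saddle_points Q A b c)"
    and growth: "quadratic_growth Q A b c \<xi> \<alpha> (cball z0 R)"
    and K_large: "real K \<ge> Max {sqrt (32 * (exp 1)\<^sup>2 * spectral_norm Q / \<alpha>),
                                32 * (exp 1)\<^sup>2 * spectral_norm A / \<alpha>,
                                sqrt (64 * spectral_norm Q / \<xi>),
                                64 * spectral_norm A / \<xi>,
                                spectral_norm Q / spectral_norm A}"
  shows "\<forall>n. norm (rapdhg Q A b c \<beta> \<theta> \<eta> \<tau> K z0 n - z0)
                 \<le> 3 / (1 - 1 / exp 1) * infdist z0 (saddle_points Q A b c) \<and>
               infdist (rapdhg Q A b c \<beta> \<theta> \<eta> \<tau> K z0 n) (saddle_points Q A b c)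
                 \<le> exp (- real n) * infdist z0 (saddle_points Q A b c)"
proof -
  let ?Z = "saddle_points Q A b c" and ?z = "rapdhg Q A b c \<beta> \<theta> \<eta> \<tau> K z0"
  let ?D = "infdist z0 ?Z"
  define e where "e = (exp 1 :: real)"
  have e: "1 < e" unfolding e_def by simp
  \<comment> \<open>The first entry makes \<open>2 * C\<close> at most
    \<open>\<alpha> / (4 * e\<^sup>2)\<close>, as the contraction requires; the second lets the
    penalty absorb the gap, with room to spare.\<close>
  define C where "C = min (\<alpha> / (8 * e\<^sup>2)) (\<xi> / 16)"
  have a: "0 < spectral_norm A" using A by (rule spectral_norm_pos)
  have q: "0 \<le> spectral_norm Q" by (rule spectral_norm_nonneg)
  have large: "sqrt (32 * e\<^sup>2 * spectral_norm Q / \<alpha>) \<le> real K" "32 * e\<^sup>2 * spectral_norm A / \<alpha> \<le> real K"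
    "sqrt (64 * spectral_norm Q / \<xi>) \<le> real K" "64 * spectral_norm A / \<xi> \<le> real K"
    "spectral_norm Q / spectral_norm A \<le> real K"
    using K_large unfolding e_def by simp_all
  have qa: "spectral_norm Q \<le> real K * spectral_norm A"
    using large(5) a by (simp add: field_simps)
  have "2 * (spectral_norm Q + real K * spectral_norm A) \<le> \<alpha> / (8 * e\<^sup>2) * (real K)\<^sup>2"
    using q a \<alpha> e K large(1,2) by (intro restart_length_bound) (simp_all add: mult_ac)
  moreover have "2 * (spectral_norm Q + real K * spectral_norm A) \<le> \<xi> / 16 * (real K)\<^sup>2"
    using q a \<xi> K large(3,4) by (intro restart_length_bound) simp_all
  ultimately have C: "2 * (spectral_norm Q + real K * spectral_norm A) \<le> C * (real K)\<^sup>2"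
    unfolding C_def by (simp add: min_def)
  have C\<alpha>: "2 * C \<le> \<alpha> * (1 / (2 * e))\<^sup>2" unfolding C_def by (simp add: power_divide power_mult_distrib)
  have C\<xi>: "4 * C \<le> \<xi>" using \<xi> unfolding C_def by simp

  \<comment> \<open>The displacement bound is unconditional, while the contraction presupposes that
    the new point lies in the ball. This separation avoids circularity in the induction
    below.\<close>
  have contraction: "norm (?z (Suc n) - ?z n) \<le> 3 * infdist (?z n) ?Z \<and>
      (norm (?z (Suc n) - z0) \<le> R \<longrightarrow> infdist (?z (Suc n)) ?Z \<le> infdist (?z n) ?Z / e)" for n
  proof -
    \<comment> \<open>The nearest saddle point is chosen anew at each restart and also serves as the
      center of the smoothed gap.\<close>
    obtain zs where zs: "zs \<in> ?Z" and d: "infdist (?z n) ?Z = norm (?z n - zs)"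
      using dist_saddle_points_attained[OF saddle] unfolding dist_norm by blast
    have zs': "zs \<in> feasible" using zs unfolding saddle_points_def by auto
    have "norm (?z (Suc n) - zs) \<le> 2 * norm (?z n - zs)"
      using apdhg_average_near_saddle[OF Q A zs \<beta> \<theta> \<eta> \<tau> K qa] by simp
    moreover have "norm (?z (Suc n) - ?z n) \<le> norm (?z (Suc n) - zs) + norm (?z n - zs)"
      using norm_triangle_ineq4[of "?z (Suc n) - zs" "?z n - zs"] by simp
    ultimately have near: "norm (?z (Suc n) - ?z n) \<le> 3 * infdist (?z n) ?Z"
      unfolding d by linarith
    have "infdist (?z (Suc n)) ?Z \<le> infdist (?z n) ?Z / e" if ball: "norm (?z (Suc n) - z0) \<le> R"
    proof -
      \<comment> \<open>Growth is applied at the new restart point, which is feasible even if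
        \<open>z0\<close> is not.\<close>
      have "?z (Suc n) \<in> feasible"
        using apdhg_average_in_convex[OF convex_feasible \<beta> apdhg_iterate_Suc_feasible, of K "K - 1"] K
        by simp
      moreover have "?z (Suc n) \<in> cball z0 R"
        using ball by (simp only: mem_cball dist_norm norm_minus_commute)
      ultimately have "\<alpha> * (infdist (?z (Suc n)) ?Z)\<^sup>2 \<le> smoothed_gap Q A b c \<xi> (?z (Suc n)) zs"
        using growth zs unfolding quadratic_growth_def by blast
      also have "\<dots> \<le> 2 * C * (norm (?z n - zs))\<^sup>2"
        using smoothed_gap_apdhg_average_le[OF Q A zs' \<beta> \<theta> \<eta> \<tau> K C C\<xi>] by simp
      also have "\<dots> \<le> \<alpha> * (1 / (2 * e))\<^sup>2 * (norm (?z n - zs))\<^sup>2"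
        using C\<alpha> by (rule mult_right_mono) simp
      also have "\<dots> = \<alpha> * (infdist (?z n) ?Z / (2 * e))\<^sup>2"
        unfolding d by (simp add: power_divide)
      finally have "infdist (?z (Suc n)) ?Z \<le> infdist (?z n) ?Z / (2 * e)"
        using \<alpha> e by (intro power2_le_imp_le[of "infdist (?z (Suc n)) ?Z"]) (auto simp: infdist_nonneg)
      also have "\<dots> \<le> infdist (?z n) ?Z / e"
        using e by (intro divide_left_mono) (auto simp: infdist_nonneg)
      finally show ?thesis .
    qed
    with near show ?thesis by blast
  qed

  have partial_sum: "(\<Sum>i<n. (1 / e) ^ i) \<le> 1 / (1 - 1 / e)" for n
  proof -
    have "(\<Sum>i<n. (1 / e) ^ i) \<le> (\<Sum>i. (1 / e) ^ i)"
      using e by (intro sum_le_suminf summable_geometric) auto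
    also have "\<dots> = 1 / (1 - 1 / e)" using e by (intro suminf_geometric) auto
    finally show ?thesis .
  qed
  have radius: "3 * ?D * (\<Sum>i<n. (1 / e) ^ i) \<le> R" for n
    using mult_left_mono[OF partial_sum[of n], of "3 * ?D"]
    unfolding R e_def by (simp add: infdist_nonneg)
  \<comment> \<open>The induction carries the partial geometric sum: the bound \<open>R\<close>, its
    limit, would leave no room for the next displacement.\<close>
  have main: "norm (?z n - z0) \<le> 3 * ?D * (\<Sum>i<n. (1 / e) ^ i) \<and> infdist (?z n) ?Z \<le> (1 / e) ^ n * ?D" for n
  proof (induction n)
    case 0
    then show ?case by simp
  next
    case (Suc n)
    have "norm (?z (Suc n) - z0) \<le> norm (?z (Suc n) - ?z n) + norm (?z n - z0)"
      using norm_triangle_ineq[of "?z (Suc n) - ?z n" "?z n - z0"] by simp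
    also have "\<dots> \<le> 3 * ((1 / e) ^ n * ?D) + 3 * ?D * (\<Sum>i<n. (1 / e) ^ i)"
      using contraction[of n] Suc by linarith
    also have "\<dots> = 3 * ?D * (\<Sum>i<Suc n. (1 / e) ^ i)"
      by (simp add: algebra_simps)
    finally have ball: "norm (?z (Suc n) - z0) \<le> 3 * ?D * (\<Sum>i<Suc n. (1 / e) ^ i)" .
    \<comment> \<open>Membership in the ball was derived from the distance at step \<open>n\<close>
      alone, so growth is now available at the new point.\<close>
    then have "infdist (?z (Suc n)) ?Z \<le> infdist (?z n) ?Z / e"
      using contraction[of n] order_trans[OF _ radius] by blast
    also have "\<dots> \<le> (1 / e) ^ n * ?D / e"
      using Suc e by (intro divide_right_mono) auto
    finally show ?case using ball by simp
  qed
  have power: "(1 / e) ^ n = exp (- real n)" for n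
    using exp_of_nat_mult[of n "-1 :: real"] unfolding e_def by (simp add: exp_minus inverse_eq_divide)
  show ?thesis
  proof (intro allI conjI)
    fix n
    show "norm (?z n - z0) \<le> 3 / (1 - 1 / exp 1) * ?D"
      using main[of n] radius[of n] unfolding R by linarith
    show "infdist (?z n) ?Z \<le> exp (- real n) * ?D"
      using main[of n] unfolding power by blast
  qed
qed

end
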